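(* Let $\lambda_1\ge\mu_1$ be positive integers with $\gcd(\lambda_1+1,\mu_1+1)=1$ and $2\mu_1>\lambda_1+1$. Then the pair $(\lambda_1,\mu_1)$ is $(\lambda_1+1)$-initial.
   Context: For a positive integer $r$, a partition with at most $r$ parts is written as a non-increasing $r$-tuple of nonnegative integers; $\mathrm{Par}_r(n)$ is the set of such tuples with entries summing to $n$. For $\lambda,\mu\in\mathrm{Par}_r(n)$, $\lambda$ dominates $\mu$ if $\sum_{i=1}^k\lambda_i\ge\sum_{i=1}^k\mu_i$ for all $k\le r$. The $r$-Kostka cone $\mathcal{K}_r\subseteq\mathbb{R}^{2r}$ is the convex hull of all points $(\lambda_1,\dots,\lambda_r,\mu_1,\dots,\mu_r)$ with $\lambda,\mu\in\mathrm{Par}_r(n)$ for some $n$ and $\lambda$ dominating $\mu$; it is a pointed rational polyhedral cone. Its Hilbert basis is the unique minimal finite set of integer points of $\mathcal{K}_r$ such that every integer point of $\mathcal{K}_r$ is a nonnegative integer combination of them; equivalently, the set of integer points of $\mathcal{K}_r$ that are not nonnegative integer combinations of other integer points of $\mathcal{K}_r$. An integer pair $(\lambda_1,\mu_1)$ is called $r$-initial if there is an element $(\lambda,\mu)$ of the Hilbert basis of $\mathcal{K}_r$ such that the first entry of $\lambda$ is $\lambda_1$ and the first entry of $\mu$ is $\mu_1$. *)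

theory Defs
  imports "HOL-Analysis.Analysis" "HOL-Analysis.Finite_Function_Topology"
begin

text \<open>
  An \<open>r\<close>-tuple is a finitely supported function on \<open>nat\<close> whose support lies in \<open>{1..r}\<close>, and
  \<open>\<real>\<^bsup>2r\<^esup>\<close> is the space of pairs of such real tuples.  The ambient vector space does not
  depend on \<open>r\<close>.
\<close>

definition Par :: "nat \<Rightarrow> nat \<Rightarrow> (nat \<Rightarrow>\<^sub>0 nat) set" where
  "Par r n = {p. Poly_Mapping.keys p \<subseteq> {1..r}
                 \<and> (\<forall>i\<in>{1..<r}. Poly_Mapping.lookup p (Suc i) \<le> Poly_Mapping.lookup p i)
                 \<and> (\<Sum>i=1..r. Poly_Mapping.lookup p i) = n}"

definition dominates :: "nat \<Rightarrow> (nat \<Rightarrow>\<^sub>0 nat) \<Rightarrow> (nat \<Rightarrow>\<^sub>0 nat) \<Rightarrow> bool" where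
  "dominates r p q \<longleftrightarrow>
     (\<forall>k\<le>r. (\<Sum>i=1..k. Poly_Mapping.lookup p i) \<ge> (\<Sum>i=1..k. Poly_Mapping.lookup q i))"

type_synonym point = "(nat \<Rightarrow>\<^sub>0 real) \<times> (nat \<Rightarrow>\<^sub>0 real)"

definition kostka_cone :: "nat \<Rightarrow> point set" where
  "kostka_cone r = convex hull
     {(Poly_Mapping.map real p, Poly_Mapping.map real q) | p q.
        \<exists>n. p \<in> Par r n \<and> q \<in> Par r n \<and> dominates r p q}"

definition integer_points :: "point set \<Rightarrow> point set" where
  "integer_points C =
     {x \<in> C. \<forall>i. Poly_Mapping.lookup (fst x) i \<in> \<int> \<and> Poly_Mapping.lookup (snd x) i \<in> \<int>}"

definition finite_generating_set :: "point set \<Rightarrow> point set \<Rightarrow> bool" where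
  "finite_generating_set C H \<longleftrightarrow>
     finite H \<and> H \<subseteq> integer_points C
     \<and> (\<forall>x\<in>integer_points C. \<exists>c :: point \<Rightarrow> nat. x = (\<Sum>h\<in>H. real (c h) *\<^sub>R h))"

text \<open>
  The definite description is well defined for pointed rational polyhedral cones, where there is
  exactly one inclusion-minimal finite generating set.
\<close>

definition hilbert_basis :: "point set \<Rightarrow> point set" where
  "hilbert_basis C =
     (THE H. finite_generating_set C H
             \<and> (\<forall>H'. finite_generating_set C H' \<and> H' \<subseteq> H \<longrightarrow> H' = H))"

definition initial_pair :: "nat \<Rightarrow> int \<times> int \<Rightarrow> bool" where
  "initial_pair r ab \<longleftrightarrow>
     (\<exists>(x, y) \<in> hilbert_basis (kostka_cone r).
        Poly_Mapping.lookup x 1 = of_int (fst ab) \<and> Poly_Mapping.lookup y 1 = of_int (snd ab))"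

end

theory Submission
  imports Defs
begin

text \<open>
  The integer points of the Kostka cone are exactly the pairs of partitions in dominance order,
  which are cut out by finitely many linear functionals with values in \<open>\<nat>\<close>. By Dickson's lemma
  such a monoid has finitely many irreducible elements; they generate it, and every generating set
  contains them, so they form the Hilbert basis.

  Write \<open>r = l + 1\<close>. In terms of columns, take for \<open>\<mu>\<close> the partition with \<open>m\<close> columns of length
  \<open>l + 1\<close>, and for \<open>\<lambda>\<close> the one with \<open>l - 1\<close> columns of length \<open>m + 1\<close> and one column of length
  \<open>2m + 1 - l\<close>. Summands of this pair split the columns into two groups. The group without the short
  column has \<open>a\<close> columns of length \<open>m + 1\<close> and \<open>k \<le> m\<close> columns of length \<open>l + 1\<close>, with
  \<open>a(m + 1) = k(l + 1)\<close>; since \<open>m + 1\<close> and \<open>l + 1\<close> are coprime, \<open>k = 0\<close> and the group is empty.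
\<close>

section \<open>Hilbert bases of lattice cones\<close>

text \<open>Dickson's lemma by induction over \<open>F\<close>: a further function only requires
  thinning the subsequence already found, and thinning preserves monotonicity of the earlier
  functions.\<close>

lemma dickson_subsequence:
  fixes F :: "('a \<Rightarrow> nat) set" and s :: "nat \<Rightarrow> 'a"
  assumes "finite F"
  shows "\<exists>g :: nat \<Rightarrow> nat. strict_mono g \<and> (\<forall>f\<in>F. mono (\<lambda>n. f (s (g n))))"
  using assms
proof (induction F rule: finite_induct)
  case empty
  show ?case by (auto intro: exI[of _ id] simp: strict_mono_def)
next
  case (insert f F)
  then obtain g :: "nat \<Rightarrow> nat" where g: "strict_mono g" "\<forall>f\<in>F. mono (\<lambda>n. f (s (g n)))" by blast
  have "\<exists>h :: nat \<Rightarrow> nat. strict_mono h \<and> mono (\<lambda>n. f (s (g (h n))))"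
  proof -
    \<comment> \<open>\<open>h\<close> enumerates indices whose value is a minimum of the remaining tail.\<close>
    define t where "t = (\<lambda>n. f (s (g n)))"
    define h where "h = rec_nat (LEAST n. \<forall>k\<ge>n. t n \<le> t k)
      (\<lambda>_ p. LEAST n. p < n \<and> (\<forall>k\<ge>n. t n \<le> t k))"
    \<comment> \<open>Among the indices beyond \<open>p\<close>, one where \<open>t\<close> is least
      is a minimum of its own tail; \<open>Suc p\<close> shows that there are candidates.\<close>
    have ex: "\<exists>n>p. \<forall>k\<ge>n. t n \<le> t k" for p
    proof -
      obtain n where "n > p" "\<forall>k. k > p \<longrightarrow> t n \<le> t k"
        using ex_has_least_nat[of "\<lambda>n. n > p" "Suc p" t] by auto
      then show ?thesis by (meson less_le_trans)
    qed
    have h0: "\<forall>k\<ge>h 0. t (h 0) \<le> t k"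
      unfolding h_def using LeastI_ex[of "\<lambda>n. \<forall>k\<ge>n. t n \<le> t k"] ex by auto
    have hS: "h n < h (Suc n) \<and> (\<forall>k\<ge>h (Suc n). t (h (Suc n)) \<le> t k)" for n
      using LeastI_ex[of "\<lambda>q. h n < q \<and> (\<forall>k\<ge>q. t q \<le> t k)"] ex[of "h n"]
      by (simp add: h_def)
    have "t (h n) \<le> t (h (Suc n))" for n
      using h0 hS less_imp_le by (cases n) blast+
    then show ?thesis
      using hS by (intro exI[of _ h]) (auto simp: strict_mono_Suc_iff mono_iff_le_Suc t_def)
  qed
  then obtain h :: "nat \<Rightarrow> nat" where h: "strict_mono h" "mono (\<lambda>n. f (s (g (h n))))" by blast
  have "mono (\<lambda>n. f' (s (g (h n))))" if "f' \<in> F" for f'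
    using g(2) that strict_mono_mono[OF h(1)] by (auto simp: mono_def)
  then show ?case
    using h strict_mono_o[OF g(1) h(1)] by (intro exI[of _ "g \<circ> h"]) (auto simp: o_def)
qed

section \<open>Monoids cut out by finitely many functionals\<close>

lemma Nats_sum: "(\<And>i. i \<in> I \<Longrightarrow> f i \<in> \<nat>) \<Longrightarrow> sum f I \<in> \<nat>"
  by (induction I rule: infinite_finite_induct) auto

definition irreducibles :: "'a::monoid_add set \<Rightarrow> 'a set" where
  "irreducibles M = {x \<in> M. x \<noteq> 0 \<and> (\<forall>y\<in>M. \<forall>z\<in>M. x = y + z \<longrightarrow> y = 0 \<or> z = 0)}"

text \<open>Linear equations go into \<open>V\<close>, inequalities into \<open>F\<close>.
  Integrality is imposed on the values of the functionals, not on coordinates. The axiom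
  \<open>pointed\<close> makes the values determine a point of \<open>V\<close>.\<close>

locale pointed_lattice_cone =
  fixes V :: "'a::real_vector set" and F :: "('a \<Rightarrow> real) set"
  assumes finite_F: "finite F"
    and subspace_V: "subspace V"
    and linear_F: "f \<in> F \<Longrightarrow> linear f"
    and pointed: "x \<in> V \<Longrightarrow> (\<And>f. f \<in> F \<Longrightarrow> f x = 0) \<Longrightarrow> x = 0"
begin

definition points :: "'a set" where
  "points = {x \<in> V. \<forall>f\<in>F. f x \<in> \<nat>}"

lemma zero_in_points: "0 \<in> points"
proof -
  have "f 0 \<in> \<nat>" if "f \<in> F" for f
    using linear_0[OF linear_F[OF that]] by simp
  then show ?thesis using subspace_0[OF subspace_V] by (simp add: points_def)
qed

lemma add_in_points:
  assumes "x \<in> points" "y \<in> points"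
  shows "x + y \<in> points"
proof -
  have "f (x + y) \<in> \<nat>" if "f \<in> F" for f
    using linear_add[OF linear_F[OF that]] assms that by (simp add: points_def)
  then show ?thesis using subspace_add[OF subspace_V] assms by (simp add: points_def)
qed

lemma scale_in_points:
  assumes "x \<in> points"
  shows "real n *\<^sub>R x \<in> points"
proof -
  have "f (real n *\<^sub>R x) \<in> \<nat>" if "f \<in> F" for f
    using linear_scale[OF linear_F[OF that]] assms that by (simp add: points_def)
  then show ?thesis using subspace_scale[OF subspace_V] assms by (simp add: points_def)
qed

lemma sum_in_points: "(\<And>i. i \<in> I \<Longrightarrow> x i \<in> points) \<Longrightarrow> sum x I \<in> points"
  by (induction I rule: infinite_finite_induct) (auto intro: zero_in_points add_in_points)

text \<open>The pointwise order of functional values implies divisibility in the monoid, which is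
  what lets Dickson's lemma produce decompositions.\<close>

lemma diff_in_points:
  assumes "x \<in> points" "y \<in> points" and le: "\<And>f. f \<in> F \<Longrightarrow> f x \<le> f y"
  shows "y - x \<in> points"
proof -
  have "f (y - x) \<in> \<nat>" if "f \<in> F" for f
  proof -
    have "f x \<in> \<nat>" "f y \<in> \<nat>" using assms(1,2) that by (auto simp: points_def)
    then obtain a b where "f x = real a" "f y = real b" by (auto simp: Nats_def)
    moreover have "f (y - x) = f y - f x"
      using linear_diff[OF linear_F[OF that]] .
    moreover have "real a \<le> real b"
      using le[OF that] calculation by simp
    ultimately have "f (y - x) = real (b - a)" by simp
    then show ?thesis by simp
  qed
  then show ?thesis
    using assms(1,2) subspace_diff[OF subspace_V] by (auto simp: points_def)
qed

text \<open>Infinitely many irreducibles would contain two distinct ones \<open>x\<close> and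
  \<open>y\<close> with all values of \<open>x\<close> at most those of \<open>y\<close>; then
  \<open>y = x + (y - x)\<close> contradicts irreducibility of \<open>y\<close>.\<close>

lemma finite_irreducibles: "finite (irreducibles points)"
proof (rule ccontr)
  assume "infinite (irreducibles points)"
  then obtain s :: "nat \<Rightarrow> 'a" where s: "inj s" "range s \<subseteq> irreducibles points"
    using infinite_countable_subset by blast
  \<comment> \<open>Dickson's lemma needs functions into \<open>nat\<close>; on
    \<open>points\<close> the floor changes no value.\<close>
  define G where "G = (\<lambda>f x. nat \<lfloor>f x\<rfloor>) ` F"
  have "finite G" using finite_F by (simp add: G_def)
  then obtain g :: "nat \<Rightarrow> nat" where g: "strict_mono g" "\<forall>f\<in>G. mono (\<lambda>n. f (s (g n)))"
    using dickson_subsequence by blast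
  define x y where "x = s (g 0)" and "y = s (g 1)"
  have irr: "x \<in> irreducibles points" "y \<in> irreducibles points"
    using s(2) by (auto simp: x_def y_def)
  then have xy: "x \<in> points" "y \<in> points" by (auto simp: irreducibles_def)
  have "f x \<le> f y" if "f \<in> F" for f
  proof -
    have "nat \<lfloor>f x\<rfloor> \<le> nat \<lfloor>f y\<rfloor>"
      using g(2) that by (auto simp: G_def mono_def x_def y_def)
    moreover have "f x \<in> \<nat>" "f y \<in> \<nat>" using xy that by (auto simp: points_def)
    ultimately show ?thesis by (auto simp: Nats_def)
  qed
  then have "y - x \<in> points" using diff_in_points xy by blast
  moreover have "y = x + (y - x)" by simp
  ultimately have "x = 0 \<or> y - x = 0"
    using irr(2) xy(1) unfolding irreducibles_def by blast
  then have "x = y" using irr(1) by (auto simp: irreducibles_def)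
  then have "g 0 = g 1" using s(1) by (simp add: x_def y_def inj_eq)
  then show False using strict_monoD[OF g(1), of 0 1] by simp
qed

lemma functional_nonneg: "x \<in> points \<Longrightarrow> f \<in> F \<Longrightarrow> 0 \<le> f x"
  unfolding points_def by (force elim: Nats_cases)

text \<open>The sum of all functionals serves as a degree: additive, natural on
  \<open>points\<close>, and zero only at the origin.\<close>

lemma functional_sum_pos:
  assumes "x \<in> points" "x \<noteq> 0"
  shows "0 < (\<Sum>f\<in>F. f x)"
proof -
  obtain f where f: "f \<in> F" "f x \<noteq> 0"
    using pointed[of x] assms unfolding points_def by blast
  then show ?thesis
    using functional_nonneg[OF assms(1)] finite_F by (intro sum_pos2[of F f]) (auto simp: less_le)
qed

text \<open>Induction on the degree: in a splitting into two nonzero points both parts have positive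
  degree, hence each has smaller degree than the whole.\<close>

lemma irreducibles_generate:
  assumes "x \<in> points"
  shows "\<exists>c :: 'a \<Rightarrow> nat. x = (\<Sum>h\<in>irreducibles points. real (c h) *\<^sub>R h)"
  using assms
proof (induction "nat \<lfloor>\<Sum>f\<in>F. f x\<rfloor>" arbitrary: x rule: less_induct)
  case less
  consider "x = 0" | "x \<in> irreducibles points"
    | y z where "y \<in> points" "z \<in> points" "x = y + z" "y \<noteq> 0" "z \<noteq> 0"
    using less.prems by (auto simp: irreducibles_def)
  then show ?case
  proof cases
    case 1
    then show ?thesis by (intro exI[of _ "\<lambda>_. 0"]) simp
  next
    case 2
    have "(\<Sum>h\<in>irreducibles points. real (if h = x then 1 else 0) *\<^sub>R h)
        = (\<Sum>h\<in>irreducibles points. if h = x then h else 0)"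
      by (intro sum.cong) auto
    also have "\<dots> = x" using 2 finite_irreducibles by simp
    finally show ?thesis by metis
  next
    case 3
    have add: "(\<Sum>f\<in>F. f x) = (\<Sum>f\<in>F. f y) + (\<Sum>f\<in>F. f z)"
      unfolding 3(3) sum.distrib[symmetric]
      by (intro sum.cong) (simp_all add: linear_add[OF linear_F])
    have nat_sum: "\<exists>n. (\<Sum>f\<in>F. f v) = real n" if "v \<in> points" for v
    proof -
      have "(\<Sum>f\<in>F. f v) \<in> \<nat>" using that by (intro Nats_sum) (auto simp: points_def)
      then show ?thesis by (auto simp: Nats_def)
    qed
    obtain a b where ab: "(\<Sum>f\<in>F. f y) = real a" "(\<Sum>f\<in>F. f z) = real b"
      using nat_sum 3 by meson
    have "a > 0" "b > 0" using functional_sum_pos[of y] functional_sum_pos[of z] 3 ab by auto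
    then have "nat \<lfloor>\<Sum>f\<in>F. f y\<rfloor> < nat \<lfloor>\<Sum>f\<in>F. f x\<rfloor>"
        "nat \<lfloor>\<Sum>f\<in>F. f z\<rfloor> < nat \<lfloor>\<Sum>f\<in>F. f x\<rfloor>"
      using add ab by linarith+
    then obtain c e :: "'a \<Rightarrow> nat" where
      "y = (\<Sum>h\<in>irreducibles points. real (c h) *\<^sub>R h)"
      "z = (\<Sum>h\<in>irreducibles points. real (e h) *\<^sub>R h)"
      using less.hyps[of y] less.hyps[of z] 3 by blast
    then have "x = (\<Sum>h\<in>irreducibles points. real (c h + e h) *\<^sub>R h)"
      by (simp add: 3(3) scaleR_add_left sum.distrib)
    then show ?thesis by (rule exI[of _ "\<lambda>h. c h + e h"])
  qed
qed

text \<open>Take one copy of a generator \<open>h\<close> with nonzero contribution out of the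
  combination. The rest \<open>z\<close> is still in \<open>points\<close>, so irreducibility forces
  \<open>z = 0\<close> and \<open>x = h\<close>.\<close>

lemma irreducible_in_generators:
  fixes c :: "'a \<Rightarrow> nat"
  assumes irr: "x \<in> irreducibles points" and H: "finite H" "H \<subseteq> points"
    and x: "x = (\<Sum>h\<in>H. real (c h) *\<^sub>R h)"
  shows "x \<in> H"
proof -
  have "\<exists>h\<in>H. real (c h) *\<^sub>R h \<noteq> 0"
    using irr x by (auto simp: irreducibles_def intro: sum.neutral)
  then obtain h where h: "h \<in> H" "c h > 0" "h \<noteq> 0" by auto
  define z where "z = real (c h - 1) *\<^sub>R h + (\<Sum>k\<in>H - {h}. real (c k) *\<^sub>R k)"
  have "z \<in> points"
    unfolding z_def using h(1) H(2)
    by (intro add_in_points scale_in_points sum_in_points) auto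
  have "h + real (c h - 1) *\<^sub>R h = real (c h) *\<^sub>R h"
    using h(2) by (simp add: scaleR_left_diff_distrib of_nat_diff)
  then have xz: "x = h + z"
    unfolding x z_def by (simp add: sum.remove[OF H(1) h(1)] add.assoc[symmetric])
  with \<open>z \<in> points\<close> h H(2) irr have "z = 0"
    unfolding irreducibles_def by blast
  then show ?thesis using xz h(1) by simp
qed

end

text \<open>The irreducibles form a finite generating set contained in every other one. A least such
  set is the only inclusion-minimal one, which settles the definite description.\<close>

lemma hilbert_basis_eq_irreducibles:
  assumes "pointed_lattice_cone V F"
    and ip: "integer_points C = pointed_lattice_cone.points V F"
  shows "hilbert_basis C = irreducibles (integer_points C)"
proof -
  interpret pointed_lattice_cone V F by fact
  let ?H = "irreducibles (integer_points C)"
  have gen: "finite_generating_set C ?H"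
    using finite_irreducibles irreducibles_generate
    by (auto simp: finite_generating_set_def ip irreducibles_def)
  have least: "?H \<subseteq> H" if "finite_generating_set C H" for H
  proof
    fix x assume x: "x \<in> ?H"
    then have "x \<in> integer_points C" by (simp add: irreducibles_def)
    then show "x \<in> H"
      using that x irreducible_in_generators[of x H] unfolding finite_generating_set_def ip by blast
  qed
  show ?thesis
    unfolding hilbert_basis_def using gen least by (intro the_equality) blast+
qed

section \<open>Integer points of the Kostka cone\<close>

definition kostka_space :: "nat \<Rightarrow> point set" where
  "kostka_space r = {z. Poly_Mapping.keys (fst z) \<subseteq> {1..r} \<and> Poly_Mapping.keys (snd z) \<subseteq> {1..r}
     \<and> (\<Sum>i=1..r. Poly_Mapping.lookup (fst z) i) = (\<Sum>i=1..r. Poly_Mapping.lookup (snd z) i)}"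

lemma kostka_space_iff:
  "z \<in> kostka_space r \<longleftrightarrow> Poly_Mapping.keys (fst z) \<subseteq> {1..r} \<and> Poly_Mapping.keys (snd z) \<subseteq> {1..r}
     \<and> (\<Sum>i=1..r. Poly_Mapping.lookup (fst z) i) = (\<Sum>i=1..r. Poly_Mapping.lookup (snd z) i)"
  by (simp add: kostka_space_def)

text \<open>On \<open>kostka_space r\<close> the entry at \<open>Suc r\<close> is 0, so the
  difference at \<open>i = r\<close> is the last entry itself; thus nonnegativity of entries is
  included.\<close>

definition kostka_functionals :: "nat \<Rightarrow> (point \<Rightarrow> real) set" where
  "kostka_functionals r =
     (\<lambda>i z. Poly_Mapping.lookup (fst z) i - Poly_Mapping.lookup (fst z) (Suc i)) ` {1..r}
   \<union> (\<lambda>i z. Poly_Mapping.lookup (snd z) i - Poly_Mapping.lookup (snd z) (Suc i)) ` {1..r}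
   \<union> (\<lambda>k z. (\<Sum>i=1..k. Poly_Mapping.lookup (fst z) i) - (\<Sum>i=1..k. Poly_Mapping.lookup (snd z) i)) ` {1..r}"


text \<open>Telescoping down from the zero entry at \<open>Suc r\<close>. It yields both pointedness
  (no differences, no entries) and integrality of entries.\<close>

lemma lookup_eq_tail_sum:
  fixes p :: "nat \<Rightarrow>\<^sub>0 real"
  assumes "Poly_Mapping.keys p \<subseteq> {1..r}" "i \<le> Suc r"
  shows "Poly_Mapping.lookup p i
    = (\<Sum>j=i..r. Poly_Mapping.lookup p j - Poly_Mapping.lookup p (Suc j))"
proof -
  have "Poly_Mapping.lookup p (Suc r) = 0"
    using assms(1) by (auto simp: in_keys_iff subset_iff)
  then show ?thesis
    using sum_Suc_diff[OF assms(2), of "\<lambda>j. - Poly_Mapping.lookup p j"] by simp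
qed

lemma lookup_outside:
  "Poly_Mapping.keys p \<subseteq> {1..r} \<Longrightarrow> i \<notin> {1..r} \<Longrightarrow> Poly_Mapping.lookup p i = 0"
  by (meson in_keys_iff subsetD)

lemma lookup_scaleR:
  "Poly_Mapping.lookup (c *\<^sub>R p) i = c *\<^sub>R Poly_Mapping.lookup p i"
proof -
  have "{i. c *\<^sub>R Poly_Mapping.lookup p i \<noteq> 0} \<subseteq> Poly_Mapping.keys p"
    by (auto simp: in_keys_iff)
  then have "finite {i. c *\<^sub>R Poly_Mapping.lookup p i \<noteq> 0}"
    using finite_subset finite_keys by blast
  then show ?thesis by (simp add: scaleR_poly_mapping_def)
qed

lemma linear_lookup: "linear (\<lambda>p. Poly_Mapping.lookup p i)"
  by (rule linearI) (simp_all add: lookup_add lookup_scaleR)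

lemma linear_lookup_fst: "linear (\<lambda>z. Poly_Mapping.lookup (fst z) i)"
  using linear_compose[OF linear_fst linear_lookup] by (simp add: o_def)

lemma linear_lookup_snd: "linear (\<lambda>z. Poly_Mapping.lookup (snd z) i)"
  using linear_compose[OF linear_snd linear_lookup] by (simp add: o_def)

lemma linear_kostka_functionals: "f \<in> kostka_functionals r \<Longrightarrow> linear f"
  unfolding kostka_functionals_def
  by (auto intro!: linear_compose_sub linear_compose_sum linear_lookup_fst linear_lookup_snd)

lemma subspace_kostka_space: "subspace (kostka_space r)"
  unfolding subspace_def
proof (intro conjI ballI allI)
  show "0 \<in> kostka_space r" by (simp add: kostka_space_iff)
next
  fix x y assume xy: "x \<in> kostka_space r" "y \<in> kostka_space r"
  have "Poly_Mapping.keys (fst (x + y)) \<subseteq> {1..r}" "Poly_Mapping.keys (snd (x + y)) \<subseteq> {1..r}"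
    using xy keys_add[of "fst x" "fst y"] keys_add[of "snd x" "snd y"]
    unfolding kostka_space_iff fst_add snd_add by blast+
  then show "x + y \<in> kostka_space r"
    using xy by (simp add: kostka_space_iff lookup_add sum.distrib)
next
  fix c :: real and x assume x: "x \<in> kostka_space r"
  have "Poly_Mapping.keys (c *\<^sub>R p) \<subseteq> Poly_Mapping.keys p" for p :: "nat \<Rightarrow>\<^sub>0 real"
    by (auto simp: in_keys_iff lookup_scaleR)
  then have "Poly_Mapping.keys (fst (c *\<^sub>R x)) \<subseteq> {1..r}" "Poly_Mapping.keys (snd (c *\<^sub>R x)) \<subseteq> {1..r}"
    using x unfolding kostka_space_iff fst_scaleR snd_scaleR by blast+
  then show "c *\<^sub>R x \<in> kostka_space r"
    using x by (simp add: kostka_space_iff lookup_scaleR flip: sum_distrib_left)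
qed

interpretation kostka: pointed_lattice_cone "kostka_space r" "kostka_functionals r" for r
proof (rule pointed_lattice_cone.intro)
  show "finite (kostka_functionals r)" by (simp add: kostka_functionals_def)
  show "subspace (kostka_space r)" by (rule subspace_kostka_space)
  show "linear f" if "f \<in> kostka_functionals r" for f
    using linear_kostka_functionals that .
  fix z :: point
  assume z: "z \<in> kostka_space r" and f0: "\<And>f. f \<in> kostka_functionals r \<Longrightarrow> f z = 0"
  show "z = 0"
  proof -
    have k: "Poly_Mapping.keys (fst z) \<subseteq> {1..r}" "Poly_Mapping.keys (snd z) \<subseteq> {1..r}"
      using z by (auto simp: kostka_space_iff)
    have d: "Poly_Mapping.lookup (fst z) i - Poly_Mapping.lookup (fst z) (Suc i) = 0"
      "Poly_Mapping.lookup (snd z) i - Poly_Mapping.lookup (snd z) (Suc i) = 0"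
      if "i \<in> {1..r}" for i
      using f0[of "\<lambda>z. Poly_Mapping.lookup (fst z) i - Poly_Mapping.lookup (fst z) (Suc i)"]
        f0[of "\<lambda>z. Poly_Mapping.lookup (snd z) i - Poly_Mapping.lookup (snd z) (Suc i)"] that
      by (auto simp: kostka_functionals_def)
    have "Poly_Mapping.lookup (fst z) i = 0" "Poly_Mapping.lookup (snd z) i = 0" for i
      using lookup_outside[OF k(1), of i] lookup_outside[OF k(2), of i]
        lookup_eq_tail_sum[OF k(1), of i] lookup_eq_tail_sum[OF k(2), of i] d
      by (cases "i \<in> {1..r}"; simp)+
    then show ?thesis by (intro prod_eqI poly_mapping_eqI) auto
  qed
qed

section \<open>Lattice points as pairs of partitions\<close>

lemma kostka_points_iff:
  "z \<in> kostka.points r \<longleftrightarrow> z \<in> kostka_space r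
   \<and> (\<forall>i\<in>{1..r}. Poly_Mapping.lookup (fst z) i - Poly_Mapping.lookup (fst z) (Suc i) \<in> \<nat>)
   \<and> (\<forall>i\<in>{1..r}. Poly_Mapping.lookup (snd z) i - Poly_Mapping.lookup (snd z) (Suc i) \<in> \<nat>)
   \<and> (\<forall>k\<in>{1..r}. (\<Sum>i=1..k. Poly_Mapping.lookup (fst z) i)
                    - (\<Sum>i=1..k. Poly_Mapping.lookup (snd z) i) \<in> \<nat>)"
  unfolding kostka.points_def unfolding kostka_functionals_def by auto

lemma kostka_points_lookup_Nats:
  assumes "z \<in> kostka.points r"
  shows "Poly_Mapping.lookup (fst z) i \<in> \<nat>" "Poly_Mapping.lookup (snd z) i \<in> \<nat>"
proof -
  have k: "Poly_Mapping.keys (fst z) \<subseteq> {1..r}" "Poly_Mapping.keys (snd z) \<subseteq> {1..r}"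
    using assms by (auto simp: kostka_points_iff kostka_space_iff)
  show "Poly_Mapping.lookup (fst z) i \<in> \<nat>"
  proof (cases "i \<in> {1..r}")
    case True
    then have "i \<le> Suc r" by simp
    show ?thesis unfolding lookup_eq_tail_sum[OF k(1) \<open>i \<le> Suc r\<close>]
      using True assms by (intro Nats_sum) (auto simp: kostka_points_iff)
  qed (simp add: lookup_outside[OF k(1)])
  show "Poly_Mapping.lookup (snd z) i \<in> \<nat>"
  proof (cases "i \<in> {1..r}")
    case True
    then have "i \<le> Suc r" by simp
    show ?thesis unfolding lookup_eq_tail_sum[OF k(2) \<open>i \<le> Suc r\<close>]
      using True assms by (intro Nats_sum) (auto simp: kostka_points_iff)
  qed (simp add: lookup_outside[OF k(2)])
qed

lemma lookup_map_real: "Poly_Mapping.lookup (Poly_Mapping.map real p) i = real (Poly_Mapping.lookup p i)"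
  by (simp add: map.rep_eq when_def)

lemma partition_pair_in_kostka_points:
  assumes p: "p \<in> Par r n" and q: "q \<in> Par r n" and dom: "dominates r p q"
  shows "(Poly_Mapping.map real p, Poly_Mapping.map real q) \<in> kostka.points r"
proof -
  \<comment> \<open>\<open>Par\<close> compares neighbours only below \<open>r\<close>; at
    \<open>i = r\<close> the next entry lies outside the support and is 0.\<close>
  have drop: "Poly_Mapping.lookup s (Suc i) \<le> Poly_Mapping.lookup s i"
    if "s \<in> Par r n" "i \<in> {1..r}" for s i
  proof (cases "i = r")
    case True
    have "Poly_Mapping.keys s \<subseteq> {1..r}" using that(1) by (simp add: Par_def)
    then show ?thesis using lookup_outside[of s r "Suc i"] True by simp
  qed (use that in \<open>auto simp: Par_def\<close>)
  have eq: "real a - real b \<in> \<nat>" if "b \<le> a" for a b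
    using that by (metis of_nat_diff of_nat_in_Nats)
  have "(\<Sum>i=1..r. real (Poly_Mapping.lookup p i)) = (\<Sum>i=1..r. real (Poly_Mapping.lookup q i))"
    using p q by (simp add: Par_def flip: of_nat_sum)
  then have "(Poly_Mapping.map real p, Poly_Mapping.map real q) \<in> kostka_space r"
    using p q by (auto simp: kostka_space_iff Par_def lookup_map_real in_keys_iff subset_iff)
  moreover have "(\<Sum>i=1..k. real (Poly_Mapping.lookup p i))
      - (\<Sum>i=1..k. real (Poly_Mapping.lookup q i)) \<in> \<nat>" if "k \<in> {1..r}" for k
    using dom that unfolding of_nat_sum[symmetric] by (intro eq) (auto simp: dominates_def)
  ultimately show ?thesis
    using drop[OF p] drop[OF q] by (auto simp: kostka_points_iff lookup_map_real intro!: eq)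
qed

text \<open>The inequalities hold at the generators and define a convex set, which therefore
  contains the hull.\<close>

lemma kostka_cone_nonneg:
  "kostka_cone r \<subseteq> {z \<in> kostka_space r. \<forall>f\<in>kostka_functionals r. 0 \<le> f z}"
  unfolding kostka_cone_def
proof (rule hull_minimal)
  show "{(Poly_Mapping.map real p, Poly_Mapping.map real q) | p q.
          \<exists>n. p \<in> Par r n \<and> q \<in> Par r n \<and> dominates r p q}
        \<subseteq> {z \<in> kostka_space r. \<forall>f\<in>kostka_functionals r. 0 \<le> f z}"
    using partition_pair_in_kostka_points kostka.functional_nonneg
    unfolding kostka.points_def by blast
  show "convex {z \<in> kostka_space r. \<forall>f\<in>kostka_functionals r. 0 \<le> f z}"
    unfolding convex_def
  proof (intro ballI allI impI CollectI conjI)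
    fix x y :: point and u v :: real and f
    assume xy: "x \<in> {z \<in> kostka_space r. \<forall>f\<in>kostka_functionals r. 0 \<le> f z}"
      "y \<in> {z \<in> kostka_space r. \<forall>f\<in>kostka_functionals r. 0 \<le> f z}" and uv: "0 \<le> u" "0 \<le> v"
    show "u *\<^sub>R x + v *\<^sub>R y \<in> kostka_space r"
      using xy by (intro subspace_add subspace_scale subspace_kostka_space) auto
    assume f: "f \<in> kostka_functionals r"
    then have "f (u *\<^sub>R x + v *\<^sub>R y) = u * f x + v * f y"
      using linear_kostka_functionals by (simp add: linear_add linear_scale)
    then show "0 \<le> f (u *\<^sub>R x + v *\<^sub>R y)"
      using xy uv f by simp
  qed
qed

text \<open>For the inclusion from right to left no convex combination has to be found: such a point
  is itself a pair of partitions in dominance order, so one of the points spanning the hull.\<close>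

lemma integer_points_kostka_cone: "integer_points (kostka_cone r) = kostka.points r"
proof (intro equalityI subsetI)
  fix z assume z: "z \<in> integer_points (kostka_cone r)"
  then have "z \<in> kostka_space r" and nonneg: "\<forall>f\<in>kostka_functionals r. 0 \<le> f z"
    using kostka_cone_nonneg by (auto simp: integer_points_def)
  moreover have "f z \<in> \<int>" if "f \<in> kostka_functionals r" for f
    using that z unfolding kostka_functionals_def integer_points_def
    by (auto intro!: Ints_diff Ints_sum)
  ultimately show "z \<in> kostka.points r"
    by (simp add: kostka.points_def Nats_altdef2)
next
  fix z assume z: "z \<in> kostka.points r"
  \<comment> \<open>The entries are already naturals, so the floor only changes their type.\<close>
  define p where "p = Poly_Mapping.map (\<lambda>t. nat \<lfloor>t\<rfloor>) (fst z)"
  define q where "q = Poly_Mapping.map (\<lambda>t. nat \<lfloor>t\<rfloor>) (snd z)"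
  have lp: "Poly_Mapping.lookup (fst z) i = real (Poly_Mapping.lookup p i)"
    and lq: "Poly_Mapping.lookup (snd z) i = real (Poly_Mapping.lookup q i)" for i
    using kostka_points_lookup_Nats[OF z, of i]
    by (auto simp: p_def q_def map.rep_eq when_def Nats_def)
  have zpq: "z = (Poly_Mapping.map real p, Poly_Mapping.map real q)"
    by (intro prod_eqI poly_mapping_eqI) (simp_all add: lookup_map_real lp lq)
  have le: "a \<le> b" if "real b - real a \<in> \<nat>" for a b
    using that by (auto simp: Nats_altdef2)
  have sum_eq: "(\<Sum>i=1..r. Poly_Mapping.lookup q i) = (\<Sum>i=1..r. Poly_Mapping.lookup p i)"
    using z by (simp add: kostka_points_iff kostka_space_iff lp lq flip: of_nat_sum)
  have par: "p \<in> Par r (\<Sum>i=1..r. Poly_Mapping.lookup p i)"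
    "q \<in> Par r (\<Sum>i=1..r. Poly_Mapping.lookup p i)"
    using z sum_eq
    by (auto simp: Par_def kostka_points_iff kostka_space_iff lp lq in_keys_iff subset_iff intro!: le)
  have "(\<Sum>i=1..k. Poly_Mapping.lookup q i) \<le> (\<Sum>i=1..k. Poly_Mapping.lookup p i)" if "k \<le> r" for k
  proof (cases "k = 0")
    case False
    then show ?thesis
      using z that by (intro le) (auto simp: kostka_points_iff lp lq)
  qed simp
  then have "dominates r p q" by (simp add: dominates_def)
  then have "z \<in> kostka_cone r"
    unfolding kostka_cone_def zpq using par by (intro hull_inc) blast
  then show "z \<in> integer_points (kostka_cone r)"
    using Nats_subset_Ints kostka_points_lookup_Nats[OF z] by (auto simp: integer_points_def)
qed

lemma hilbert_basis_kostka_cone: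
  "hilbert_basis (kostka_cone r) = irreducibles (kostka.points r)"
  using hilbert_basis_eq_irreducibles[OF kostka.pointed_lattice_cone_axioms]
  by (simp add: integer_points_kostka_cone)


section \<open>An irreducible pair\<close>

text \<open>The columns of the pair read as rows: all \<open>l\<close> columns reach the first
  \<open>2 * m + 1 - l\<close> rows, and only the \<open>l - 1\<close> long ones continue to row
  \<open>m + 1\<close>. The short length is what \<open>m * (l + 1) - (l - 1) * (m + 1)\<close>
  leaves over.\<close>

definition witness :: "nat \<Rightarrow> nat \<Rightarrow> point" where
  "witness l m =
    (Poly_Mapping.Abs_poly_mapping
       (\<lambda>i. if i \<in> {1..2 * m + 1 - l} then real l else if i \<in> {1..m + 1} then real l - 1 else 0),
     Poly_Mapping.Abs_poly_mapping (\<lambda>i. if i \<in> {1..l + 1} then real m else 0))"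

lemma lookup_fst_witness:
  "Poly_Mapping.lookup (fst (witness l m)) i =
    (if i \<in> {1..2 * m + 1 - l} then real l else if i \<in> {1..m + 1} then real l - 1 else 0)"
proof -
  have "finite {i. (if i \<in> {1..2 * m + 1 - l} then real l
      else if i \<in> {1..m + 1} then real l - 1 else 0) \<noteq> 0}"
    by (rule finite_subset[of _ "{1..2 * m + 1 - l} \<union> {1..m + 1}"]) (auto split: if_splits)
  then show ?thesis unfolding witness_def by simp
qed

lemma lookup_snd_witness:
  "Poly_Mapping.lookup (snd (witness l m)) i = (if i \<in> {1..l + 1} then real m else 0)"
proof -
  have "finite {i. (if i \<in> {1..l + 1} then real m else 0) \<noteq> 0}"
    by (rule finite_subset[of _ "{1..l + 1}"]) (auto split: if_splits)
  then show ?thesis unfolding witness_def by simp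
qed

lemma sum_fst_witness:
  assumes "m < l" "l \<le> 2 * m"
  shows "(\<Sum>i=1..l + 1. Poly_Mapping.lookup (fst (witness l m)) i) = real m * (real l + 1)"
proof -
  let ?d = "2 * m + 1 - l"
  \<comment> \<open>Separate the short column, contributing 1 to each of its rows, from the
    \<open>l - 1\<close> long ones.\<close>
  have "(\<Sum>i=1..l + 1. Poly_Mapping.lookup (fst (witness l m)) i)
      = (\<Sum>i=1..l + 1. (if i \<in> {1..?d} then 1 else 0) + (if i \<in> {1..m + 1} then real l - 1 else 0))"
    using assms by (intro sum.cong) (auto simp: lookup_fst_witness)
  also have "\<dots> = real (card ({1..l + 1} \<inter> {1..?d})) + real (card ({1..l + 1} \<inter> {1..m + 1})) * (real l - 1)"
    by (simp only: sum.distrib sum.inter_restrict[symmetric] finite_atLeastAtMost sum_constant mult_1_right)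
  also have "{1..l + 1} \<inter> {1..?d} = {1..?d}"
    using assms by auto
  also have "{1..l + 1} \<inter> {1..m + 1} = {1..m + 1}"
    using assms by auto
  also have "real (card {1..?d}) = 2 * real m + 1 - real l"
    using assms by (simp add: of_nat_diff)
  finally show ?thesis by (simp add: algebra_simps)
qed

lemma witness_in_kostka_points:
  assumes "m < l" "l \<le> 2 * m"
  shows "witness l m \<in> kostka.points (l + 1)"
proof -
  let ?x = "Poly_Mapping.lookup (fst (witness l m))" and ?y = "Poly_Mapping.lookup (snd (witness l m))"
  have sum_y: "(\<Sum>i=1..l + 1. ?y i) = real m * (real l + 1)"
    by (simp add: lookup_snd_witness algebra_simps)
  have space: "witness l m \<in> kostka_space (l + 1)"
    using assms sum_y sum_fst_witness[OF assms]
    by (auto simp: kostka_space_iff in_keys_iff lookup_fst_witness lookup_snd_witness split: if_splits)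
  have Ints: "?x i \<in> \<int>" "?y i \<in> \<int>" for i
    by (auto simp: lookup_fst_witness lookup_snd_witness)
  have "?x i - ?x (Suc i) \<ge> 0" "?y i - ?y (Suc i) \<ge> 0" if "i \<in> {1..l + 1}" for i
    using that assms by (auto simp: lookup_fst_witness lookup_snd_witness)
  moreover have "(\<Sum>i=1..k. ?x i) - (\<Sum>i=1..k. ?y i) \<ge> 0" if k: "k \<in> {1..l + 1}" for k
  proof (cases "k \<le> m + 1")
    \<comment> \<open>Up to row \<open>m + 1\<close> the comparison is entrywise, since
      \<open>l - 1 \<ge> m\<close>. Beyond it the first tuple has reached its full sum, which equals
      that of the second.\<close>
    case True
    then have "(\<Sum>i=1..k. ?y i) \<le> (\<Sum>i=1..k. ?x i)"
      using assms by (intro sum_mono) (auto simp: lookup_fst_witness lookup_snd_witness)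
    then show ?thesis by simp
  next
    case False
    have "(\<Sum>i=1..k. ?x i) = (\<Sum>i=1..l + 1. ?x i)"
      using k False assms by (intro sum.mono_neutral_left) (auto simp: lookup_fst_witness)
    moreover have "(\<Sum>i=1..k. ?y i) \<le> (\<Sum>i=1..l + 1. ?y i)"
      using k by (intro sum_mono2) (auto simp: lookup_snd_witness)
    ultimately show ?thesis using sum_y sum_fst_witness[OF assms] by simp
  qed
  ultimately show ?thesis
    using space Ints by (auto simp: kostka_points_iff Nats_altdef2 intro!: Ints_diff Ints_sum)
qed

lemma constant_on_run:
  fixes g :: "nat \<Rightarrow> 'a"
  assumes "\<And>j. a \<le> j \<Longrightarrow> j < b \<Longrightarrow> g j = g (Suc j)" "a \<le> i" "i \<le> b"
  shows "g i = g b"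
  using assms(3,2)
proof (induction rule: inc_induct)
  case (step n)
  then show ?case using assms(1)[of n] by simp
qed simp

text \<open>The hypothesis \<open>no_step\<close> says that the short column does not belong to
  \<open>u\<close>. Drops of \<open>u\<close> and \<open>v\<close> are nonnegative and add up to
  those of the pair, so \<open>u\<close> can drop only where the pair does.\<close>

lemma witness_summand_eq_0:
  assumes ml: "m < l" "l \<le> 2 * m" and cop: "coprime (l + 1) (m + 1)"
    and u: "u \<in> kostka.points (l + 1)" and v: "v \<in> kostka.points (l + 1)"
    and uv: "witness l m = u + v"
    and no_step: "Poly_Mapping.lookup (fst u) (2 * m + 1 - l)
                = Poly_Mapping.lookup (fst u) (Suc (2 * m + 1 - l))"
  shows "u = 0"
proof -
  let ?p = "Poly_Mapping.lookup (fst u)" and ?q = "Poly_Mapping.lookup (snd u)"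
  let ?p' = "Poly_Mapping.lookup (fst v)" and ?q' = "Poly_Mapping.lookup (snd v)"
  define d where "d = 2 * m + 1 - l"
  have d: "1 \<le> d" "d < m + 1" using ml by (auto simp: d_def)
  have sum_p: "?p i + ?p' i = (if i \<in> {1..d} then real l else if i \<in> {1..m + 1} then real l - 1 else 0)"
    and sum_q: "?q i + ?q' i = (if i \<in> {1..l + 1} then real m else 0)" for i
    using uv lookup_fst_witness[of l m i] lookup_snd_witness[of l m i]
    by (auto simp: lookup_add d_def)
  have drop: "?p (Suc i) \<le> ?p i" "?p' (Suc i) \<le> ?p' i" "?q (Suc i) \<le> ?q i" "?q' (Suc i) \<le> ?q' i"
    if "i \<in> {1..l + 1}" for i
    using u v that by (auto simp: kostka_points_iff Nats_altdef2)
  have nonneg: "0 \<le> ?p i" "0 \<le> ?p' i" "0 \<le> ?q i" "0 \<le> ?q' i" for i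
    using kostka_points_lookup_Nats[OF u, of i] kostka_points_lookup_Nats[OF v, of i]
    by (auto simp: Nats_altdef2)
  have keys: "Poly_Mapping.keys (fst u) \<subseteq> {1..l + 1}" "Poly_Mapping.keys (snd u) \<subseteq> {1..l + 1}"
    and total: "(\<Sum>i=1..l + 1. ?p i) = (\<Sum>i=1..l + 1. ?q i)"
    using u by (auto simp: kostka_points_iff kostka_space_iff)
  obtain a k where a: "?p (m + 1) = real a" and k: "?q (l + 1) = real k"
    using kostka_points_lookup_Nats[OF u] by (metis Nats_cases)
  have q: "?q i = real k" if "i \<in> {1..l + 1}" for i
  proof -
    have "?q j = ?q (Suc j)" if "1 \<le> j" "j < l + 1" for j
      using drop(3,4)[of j] sum_q[of j] sum_q[of "Suc j"] that by auto
    then show ?thesis using constant_on_run[of 1 "l + 1" ?q i] that k by auto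
  qed
  have p_high: "?p i = 0" if "i \<notin> {1..m + 1}" for i
    using sum_p[of i] nonneg(1,2)[of i] that d by auto
  have p_low: "?p i = real a" if "i \<in> {1..m + 1}" for i
  proof -
    \<comment> \<open>The first tuple of the pair drops before row \<open>m + 1\<close> only at
      \<open>d\<close>, where \<open>no_step\<close> applies.\<close>
    have "?p j = ?p (Suc j)" if "1 \<le> j" "j < m + 1" for j
    proof (cases "j = d")
      case True
      then show ?thesis using no_step by (simp add: d_def)
    next
      case False
      then show ?thesis
        using drop(1,2)[of j] sum_p[of j] sum_p[of "Suc j"] that ml by (auto split: if_splits)
    qed
    then show ?thesis using constant_on_run[of 1 "m + 1" ?p i] that a by auto
  qed
  have "(\<Sum>i=1..l + 1. ?p i) = (\<Sum>i=1..m + 1. ?p i)"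
    using ml p_high by (intro sum.mono_neutral_right) auto
  also have "\<dots> = real ((m + 1) * a)" using p_low by (simp add: algebra_simps)
  finally have "real ((m + 1) * a) = real ((l + 1) * k)"
    using total q by (simp add: algebra_simps)
  then have eq: "(m + 1) * a = (l + 1) * k" by (simp only: of_nat_eq_iff)
  then have "m + 1 dvd (l + 1) * k" by (metis dvd_triv_left)
  then have "m + 1 dvd k"
    using coprime_dvd_mult_right_iff[of "m + 1" "l + 1" k] cop by (metis coprime_commute)
  \<comment> \<open>The last entries of the two second tuples are nonnegative with sum
    \<open>m\<close>; a multiple of \<open>m + 1\<close> this small is 0.\<close>
  moreover have "k \<le> m"
    using sum_q[of "l + 1"] nonneg(4)[of "l + 1"] k by simp
  ultimately have "k = 0" by (auto dest: dvd_imp_le)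
  then have "a = 0" using eq by simp
  have "?p i = 0" "?q i = 0" for i
    using p_low p_high q \<open>k = 0\<close> \<open>a = 0\<close> lookup_outside[OF keys(2)]
    by (metis of_nat_0)+
  then show ?thesis by (intro prod_eqI poly_mapping_eqI) auto
qed

lemma witness_irreducible:
  assumes ml: "m < l" "l \<le> 2 * m" and cop: "coprime (l + 1) (m + 1)"
  shows "witness l m \<in> irreducibles (kostka.points (l + 1))"
proof -
  let ?d = "2 * m + 1 - l"
  have "Poly_Mapping.lookup (snd (witness l m)) 1 = real m"
    by (simp add: lookup_snd_witness)
  then have "witness l m \<noteq> 0" using ml by auto
  moreover have "u = 0 \<or> v = 0"
    if uv: "u \<in> kostka.points (l + 1)" "v \<in> kostka.points (l + 1)" "witness l m = u + v" for u v
  proof -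
    let ?p = "Poly_Mapping.lookup (fst u)" and ?p' = "Poly_Mapping.lookup (fst v)"
    have d: "?d \<in> {1..l + 1}" "?d \<le> m" using ml by auto
    have "?p ?d - ?p (Suc ?d) \<in> \<nat>" "?p' ?d - ?p' (Suc ?d) \<in> \<nat>"
      using uv d unfolding kostka_points_iff by blast+
    then obtain a b where ab: "?p ?d - ?p (Suc ?d) = real a" "?p' ?d - ?p' (Suc ?d) = real b"
      by (metis Nats_cases)
    \<comment> \<open>The pair drops from \<open>l\<close> to \<open>l - 1\<close> here, and 1 is a
      sum of two naturals only as 0 + 1 or 1 + 0. So one summand has no drop, and the preceding
      lemma applies to it, with the roles exchanged if necessary.\<close>
    have "(?p ?d + ?p' ?d) - (?p (Suc ?d) + ?p' (Suc ?d)) = 1"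
      using arg_cong[OF uv(3), of "\<lambda>z. Poly_Mapping.lookup (fst z) ?d"]
        arg_cong[OF uv(3), of "\<lambda>z. Poly_Mapping.lookup (fst z) (Suc ?d)"] ml d
      by (simp add: lookup_fst_witness lookup_add)
    then have "real (a + b) = 1" using ab by simp
    then have "a + b = 1" by linarith
    then have "a = 0 \<or> b = 0" by auto
    moreover have "witness l m = v + u" using uv(3) by (simp add: add.commute)
    ultimately show ?thesis
      using witness_summand_eq_0[OF ml cop uv] witness_summand_eq_0[OF ml cop uv(2,1)] ab by auto
  qed
  ultimately show ?thesis
    using witness_in_kostka_points[OF ml] by (auto simp: irreducibles_def)
qed

theorem theorem6p9:
  fixes l m :: nat
  assumes "0 < m" and "m \<le> l"
    and "gcd (l + 1) (m + 1) = 1"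
    and "2 * m > l + 1"
  shows "initial_pair (l + 1) (int l, int m)"
proof -
  \<comment> \<open>Equality would make the gcd \<open>m + 1 > 1\<close>. Strictness ends the short
    column before row \<open>m + 1\<close>, and \<open>l \<le> 2 * m\<close> gives it at least one
    row, so that the first entry is \<open>l\<close>.\<close>
  have "m \<noteq> l" using assms(1,3) by auto
  then have ml: "m < l" "l \<le> 2 * m" using assms by auto
  have "coprime (l + 1) (m + 1)" using assms(3) by (simp add: coprime_iff_gcd_eq_1)
  then have "witness l m \<in> hilbert_basis (kostka_cone (l + 1))"
    using witness_irreducible[OF ml] by (simp only: hilbert_basis_kostka_cone)
  moreover have "Poly_Mapping.lookup (fst (witness l m)) 1 = real l"
    "Poly_Mapping.lookup (snd (witness l m)) 1 = real m"
    using ml by (simp_all add: lookup_fst_witness lookup_snd_witness)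
  ultimately show ?thesis
    unfolding initial_pair_def by (intro bexI[of _ "witness l m"]) (auto simp: case_prod_beta)
qed

end
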